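(* Let $a$ be an odd abundant perfect square (that is, $a$ is the square of an integer, $a$ is odd, and $\sigma(a) > 2a$). If $p$ is a prime such that $p > \sigma(a)$, then $n = ap$ is an odd nonsquare abundant number (that is, $n$ is odd, $n$ is not the square of an integer, and $\sigma(n) > 2n$), but $n$ is not $\{-1,1\}$-perfect.
   Context: $\sigma(n) = \sum_{d \mid n} d$ is the sum of the positive divisors of $n$. A positive integer $n$ is abundant if $\sigma(n) > 2n$. For a positive integer $n$, write its positive divisors as $1 = d_0 < d_1 < \cdots < d_k < d_{k+1} = n$ (so $n>1$, and $k=0$ is allowed). The integer $n$ is $\{-1,1\}$-perfect if there are $\lambda_1, \ldots, \lambda_k \in \{-1,1\}$ with $1 + \sum_{j=1}^{k} \lambda_j d_j = n$. *)

theory Defs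
  imports "HOL-Computational_Algebra.Computational_Algebra"
begin

definition divisor_sigma :: "nat \<Rightarrow> nat" where
  "divisor_sigma n = (\<Sum>d | d dvd n. d)"

definition abundant :: "nat \<Rightarrow> bool" where
  "abundant n \<longleftrightarrow> n > 0 \<and> divisor_sigma n > 2 * n"

(* The signs lambda_1, ..., lambda_k attached to the divisors d_1 < ... < d_k are given as a
   function l of the divisor, so l d_j is lambda_j; the set below is exactly {d_1, ..., d_k}
   (empty if n is prime). The sum is taken in the integers. *)
definition pm1_perfect :: "nat \<Rightarrow> bool" where
  "pm1_perfect n \<longleftrightarrow> n > 1 \<and>
     (\<exists>l :: nat \<Rightarrow> int. (\<forall>d \<in> {d. d dvd n \<and> 1 < d \<and> d < n}. l d \<in> {-1, 1}) \<and>
        1 + (\<Sum>d | d dvd n \<and> 1 < d \<and> d < n. l d * int d) = int n)"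

end

theory Submission
  imports Defs
begin

text \<open>Since p does not divide a, the divisors of ap are the d and the dp with d dividing a.
  A signed sum of all divisors of ap equal to 0 therefore has the form S + pT = 0, where S is
  a signed sum of the divisors of a. Then p divides S, and |S| is at most sigma(a) < p, so S = 0.
  But S has the parity of sigma(a), which is odd because a is an odd square.\<close>

text \<open>A divisor of \<open>a * p\<close> that is not a multiple of \<open>p\<close> is coprime
  to \<open>p\<close>, hence divides \<open>a\<close>. The summand is arbitrary because the
  splitting serves twice: for signed integer sums and for sigma itself.\<close>

lemma sum_divisors_mult_prime:
  fixes a p :: nat and f :: "nat \<Rightarrow> 'b::comm_monoid_add"
  assumes "a > 0" and "prime p" and "\<not> p dvd a"
  shows "(\<Sum>d | d dvd a * p. f d) = (\<Sum>d | d dvd a. f d) + (\<Sum>d | d dvd a. f (d * p))"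
proof -
  have p0: "p > 0" using assms(2) by (rule prime_gt_0_nat)
  have split: "{d. d dvd a * p} = {d. d dvd a} \<union> (\<lambda>d. d * p) ` {d. d dvd a}"
  proof (intro subset_antisym subsetI)
    fix d assume "d \<in> {d. d dvd a * p}"
    then have d: "d dvd a * p" by simp
    show "d \<in> {d. d dvd a} \<union> (\<lambda>d. d * p) ` {d. d dvd a}"
    proof (cases "p dvd d")
      case True
      then obtain e where "d = e * p" by (metis dvdE mult.commute)
      with d p0 show ?thesis by auto
    next
      case False
      then have "coprime d p" using assms(2) by (metis coprime_commute prime_imp_coprime)
      with d show ?thesis by (simp add: coprime_dvd_mult_left_iff)
    qed
  qed auto
  have "{d. d dvd a} \<inter> (\<lambda>d. d * p) ` {d. d dvd a} = {}"
    using assms(3) by (auto dest: dvd_mult_right)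
  moreover have "inj_on (\<lambda>d. d * p) {d. d dvd a}" using p0 by (simp add: inj_on_def)
  ultimately show ?thesis
    using assms(1) by (simp add: split sum.union_disjoint sum.reindex)
qed

text \<open>The involution sending \<open>d\<close> to \<open>a div d\<close> swaps the divisors
  below the root \<open>s\<close> with those above it and fixes only \<open>s\<close>. Each pair
  consists of two odd numbers and so has an even sum; what remains is \<open>s\<close>, which is
  odd.\<close>

lemma odd_divisor_sigma_square:
  fixes a :: nat
  assumes "is_square a" and "odd a"
  shows "odd (divisor_sigma a)"
proof -
  obtain s where s: "a = s * s" using assms(1) by (auto simp: is_nth_power_def power2_eq_square)
  have a0: "a > 0" using assms(2) by (rule odd_pos)
  then have s0: "s > 0" using s by simp
  have fin: "finite {d. d dvd a}" using a0 by simp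
  let ?L = "{d. d dvd a \<and> d < s}" and ?R = "{d. d dvd a \<and> s < d}"
  have finL: "finite ?L" and finR: "finite ?R" using fin by auto
  have refl: "a div d \<in> ?R" if "d \<in> ?L" for d
  proof -
    from that obtain e where e: "a = d * e" and ds: "d < s" by auto
    have "s < e"
    proof (rule ccontr)
      assume "\<not> s < e"
      then have "d * e \<le> d * s" by simp
      also have "\<dots> < s * s" using ds s0 by simp
      finally show False using e s by simp
    qed
    moreover have "d > 0" using e a0 by (cases d) auto
    ultimately show ?thesis using e by auto
  qed
  have refr: "a div d \<in> ?L" if "d \<in> ?R" for d
  proof -
    from that obtain e where e: "a = d * e" and ds: "s < d" by auto
    have "e < s"
    proof (rule ccontr)
      assume "\<not> e < s"
      then have "s * s < d * e" using ds s0 by (intro mult_less_le_imp_less) auto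
      then show False using e s by simp
    qed
    moreover have "d > 0" using ds by simp
    ultimately show ?thesis using e by auto
  qed
  have inv: "a div (a div d) = d" if "d dvd a" for d
    using that a0 by auto
  have R: "(\<Sum>d\<in>?R. d) = (\<Sum>d\<in>?L. a div d)"
    by (rule sum.reindex_bij_witness[where i = "\<lambda>d. a div d" and j = "\<lambda>d. a div d"])
       (use refl refr inv in auto)
  have "{d. d dvd a} = insert s (?L \<union> ?R)" using s by auto
  then have "divisor_sigma a = (\<Sum>d\<in>insert s (?L \<union> ?R). d)"
    unfolding divisor_sigma_def by (rule arg_cong)
  also have "\<dots> = s + (\<Sum>d\<in>?L \<union> ?R. d)"
    using finL finR by (intro sum.insert) auto
  also have "(\<Sum>d\<in>?L \<union> ?R. d) = (\<Sum>d\<in>?L. d) + (\<Sum>d\<in>?R. d)"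
    using finL finR by (intro sum.union_disjoint) auto
  also have "\<dots> = (\<Sum>d\<in>?L. d + a div d)" by (simp add: R sum.distrib)
  finally have eq: "divisor_sigma a = s + (\<Sum>d\<in>?L. d + a div d)" .
  have "even (d + a div d)" if "d \<in> ?L" for d
  proof -
    from that obtain e where "a = d * e" by auto
    \<comment> \<open>For \<open>d = 0\<close> the factorization would make \<open>a\<close> zero,
      which is even. Otherwise \<open>a div d\<close> is \<open>e\<close>, and both factors of an
      odd number are odd.\<close>
    then show ?thesis using assms(2) by (cases "d = 0") auto
  qed
  then have "even (\<Sum>d\<in>?L. d + a div d)" by (rule dvd_sum)
  moreover have "odd s" using s assms(2) by simp
  ultimately show ?thesis by (simp add: eq)
qed

text \<open>Flipping the sign of a term changes the sum by twice that term.\<close>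

lemma signed_sum_parity:
  fixes e :: "nat \<Rightarrow> int"
  assumes "\<And>d. d \<in> A \<Longrightarrow> e d \<in> {-1, 1}"
  shows "even ((\<Sum>d\<in>A. e d * int d) - int (\<Sum>A))"
proof -
  have "even (e d * int d - int d)" if "d \<in> A" for d
    using assms[OF that] by auto
  then have "even (\<Sum>d\<in>A. e d * int d - int d)" by (rule dvd_sum)
  then show ?thesis by (simp add: sum_subtractf)
qed

lemma signed_sum_bound:
  fixes e :: "nat \<Rightarrow> int"
  assumes "\<And>d. d \<in> A \<Longrightarrow> e d \<in> {-1, 1}"
  shows "\<bar>\<Sum>d\<in>A. e d * int d\<bar> \<le> int (\<Sum>A)"
proof -
  have "\<bar>\<Sum>d\<in>A. e d * int d\<bar> \<le> (\<Sum>d\<in>A. \<bar>e d * int d\<bar>)" by (rule sum_abs)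
  also have "\<dots> = (\<Sum>d\<in>A. int d)"
    using assms by (intro sum.cong) (fastforce simp: abs_mult)+
  finally show ?thesis by simp
qed

text \<open>Moving \<open>n\<close> to the other side of the defining equation gives it the sign -1,
  while 1 has the sign 1. Now every divisor carries a sign, and
  \<open>sum_divisors_mult_prime\<close> can be applied.\<close>

lemma pm1_perfect_signed_divisor_sum:
  assumes "pm1_perfect n"
  obtains e :: "nat \<Rightarrow> int"
  where "\<And>d. d dvd n \<Longrightarrow> e d \<in> {-1, 1}" and "(\<Sum>d | d dvd n. e d * int d) = 0"
proof -
  let ?P = "{d. d dvd n \<and> 1 < d \<and> d < n}"
  obtain l :: "nat \<Rightarrow> int" where n: "n > 1" and l: "\<And>d. d \<in> ?P \<Longrightarrow> l d \<in> {-1, 1}"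
    and sum: "1 + (\<Sum>d\<in>?P. l d * int d) = int n"
    using assms unfolding pm1_perfect_def by blast
  define e where "e = l(1 := 1, n := -1)"
  have dvds: "{d. d dvd n} = insert 1 (insert n ?P)"
  proof -
    have "d = 1 \<or> d = n \<or> 1 < d \<and> d < n" if "d dvd n" for d
      using dvd_imp_le[OF that] dvd_pos_nat[OF _ that] n by linarith
    then show ?thesis by auto
  qed
  have "(\<Sum>d\<in>?P. e d * int d) = (\<Sum>d\<in>?P. l d * int d)"
    by (intro sum.cong) (auto simp: e_def)
  \<comment> \<open>Here \<open>n > 1\<close> keeps the two updates in \<open>e\<close> from
    colliding.\<close>
  moreover have "e 1 = 1" "e n = -1" using n by (auto simp: e_def)
  moreover have "finite ?P" by simp
  ultimately have "(\<Sum>d | d dvd n. e d * int d) = 0"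
    unfolding dvds using n sum by simp
  moreover have "e d \<in> {-1, 1}" if "d dvd n" for d
  proof -
    have "d \<in> insert 1 (insert n ?P)" using that dvds by blast
    then show ?thesis using l by (auto simp: e_def)
  qed
  ultimately show thesis using that by blast
qed

lemma not_pm1_perfect_mult_prime:
  fixes a p :: nat
  assumes "a > 0" and "prime p" and "p > divisor_sigma a" and "odd (divisor_sigma a)"
    and "\<not> p dvd a"
  shows "\<not> pm1_perfect (a * p)"
proof
  assume "pm1_perfect (a * p)"
  then obtain e :: "nat \<Rightarrow> int" where e: "\<And>d. d dvd a * p \<Longrightarrow> e d \<in> {-1, 1}"
    and sum: "(\<Sum>d | d dvd a * p. e d * int d) = 0"
    by (rule pm1_perfect_signed_divisor_sum) blast
  define S where "S = (\<Sum>d | d dvd a. e d * int d)"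
  have eD: "e d \<in> {-1, 1}" if "d \<in> {d. d dvd a}" for d using e that by simp
  \<comment> \<open>The divisors \<open>d * p\<close> have signs of their own, but together they
    contribute an integer multiple of \<open>p\<close>.\<close>
  have "S + (\<Sum>d | d dvd a. e (d * p) * int d) * int p = 0"
    using sum sum_divisors_mult_prime[OF assms(1,2,5), of "\<lambda>d. e d * int d"]
    by (simp add: S_def sum_distrib_right mult.assoc)
  then have "int p dvd S" by (metis dvd_0_right dvd_add_times_triv_right_iff)
  moreover have "\<bar>S\<bar> < int p"
    using signed_sum_bound[of "{d. d dvd a}" e, OF eD] assms(3)
    unfolding S_def divisor_sigma_def by linarith
  ultimately have "S = 0" by (metis abs_of_nat dvd_imp_le_int not_le)
  then show False
    \<comment> \<open>With \<open>S = 0\<close> this says that sigma(a) is even. Deleting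
      \<open>of_nat_sum\<close> keeps the plain divisor sum intact, so that it folds back to
      \<open>divisor_sigma a\<close>.\<close>
    using signed_sum_parity[of "{d. d dvd a}" e, OF eD] assms(4)
    by (simp del: of_nat_sum flip: S_def divisor_sigma_def)
qed

theorem theorem3p1:
  fixes a p :: nat
  assumes "is_square a" and "odd a" and "abundant a"
    and "prime p" and "p > divisor_sigma a"
  shows "odd (a * p) \<and> \<not> is_square (a * p) \<and> abundant (a * p) \<and> \<not> pm1_perfect (a * p)"
proof (intro conjI)
  have a0: "a > 0" and ab: "divisor_sigma a > 2 * a" using assms(3) by (auto simp: abundant_def)
  have ndvd: "\<not> p dvd a" using dvd_imp_le[of p a] a0 ab assms(5) by linarith
  have "p > 2" using a0 ab assms(5) by linarith
  then show "odd (a * p)" using assms(2,4) prime_odd_nat by simp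
  show "\<not> is_square (a * p)"
  proof
    assume "is_square (a * p)"
    then obtain b where b: "a * p = b * b" by (auto simp: is_nth_power_def power2_eq_square)
    \<comment> \<open>Since \<open>p\<close> divides \<open>b\<close>, its square divides
      \<open>a * p\<close>, which forces \<open>p\<close> to divide \<open>a\<close>.\<close>
    then have "p dvd b" using assms(4) by (metis dvd_triv_right prime_dvd_mult_iff)
    then obtain c where "b = p * c" ..
    then have "a = p * (c * c)" using b \<open>p > 2\<close> by simp
    then show False using ndvd by simp
  qed
  have "divisor_sigma (a * p) = divisor_sigma a + divisor_sigma a * p"
    unfolding divisor_sigma_def
    using sum_divisors_mult_prime[OF a0 assms(4) ndvd, of "\<lambda>d. d"]
    by (simp add: sum_distrib_right)
  \<comment> \<open>The part of sigma(ap) coming from the divisors \<open>d * p\<close> already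
    exceeds 2ap.\<close>
  moreover have "2 * a * p < divisor_sigma a * p" using ab \<open>p > 2\<close> by simp
  ultimately have "2 * (a * p) < divisor_sigma (a * p)" by linarith
  then show "abundant (a * p)" using a0 \<open>p > 2\<close> by (simp add: abundant_def)
  show "\<not> pm1_perfect (a * p)"
    using a0 assms(4,5) odd_divisor_sigma_square[OF assms(1,2)] ndvd
    by (rule not_pm1_perfect_mult_prime)
qed

end
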